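(* Let $0<p<1$ and let $\tilde K=[0,\operatorname{diam}\tilde K]\setminus\bigsqcup_n (a_n,b_n)\subset\mathbb R$ be a Cantor set satisfying condition $(\mathcal C_p)$, where the $(a_n,b_n)$ are the connected components of $[0,\operatorname{diam}\tilde K]\setminus\tilde K$. Put $l_n:=b_n-a_n$. Let $K\subset\mathbb R$ be a regular Cantor set of dimension $d<1-p$ and box fuzzy measure $C_K$ satisfying $$\sum_{\{n:\ l_n>\operatorname{diam}K\}}(\operatorname{diam}K+l_n)+2C_K\sum_{\{n:\ l_n\le \operatorname{diam}K\}} l_n^{\,1-d}<\operatorname{diam}(\tilde K)-\operatorname{diam}(K).$$ Then the set of parameters $t\in\mathbb R$ such that $t+K\subset\tilde K$ has positive Lebesgue measure. More precisely, its Lebesgue measure is at least $$\operatorname{diam}(\tilde K)-\operatorname{diam}(K)-\Big(\sum_{\{n:\ l_n>\operatorname{diam}K\}}(\operatorname{diam}K+l_n)+2C_K\sum_{\{n:\ l_n\le \operatorname{diam}K\}} l_n^{\,1-d}\Big).$$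
   Context: Condition $(\mathcal C_p)$, $0<p<1$: a compact set $\tilde K\subset\mathbb R$ with convex hull $[a,a+\operatorname{diam}\tilde K]$, whose complementary components in the hull are the open intervals $(a_n,b_n)$, satisfies $(\mathcal C_p)$ if $\sum_n (b_n-a_n)^p<\infty$. Regular Cantor set: a Cantor set $K\subset\mathbb R$ is $C^k$-regular ($k\ge1$) if (i) there are disjoint compact intervals $I_1,\dots,I_r$ such that $K\subset I_1\cup\dots\cup I_r$ and the boundary of each $I_j$ is contained in $K$; (ii) there is a $C^k$ expanding map $\psi$ defined in a neighbourhood of $I_1\cup\dots\cup I_r$ such that each $\psi(I_j)$ is the convex hull of a finite union of some of the intervals $I_s$, for each $j$ and all sufficiently large $n$ one has $\psi^n(K\cap I_j)=K$, and $K=\bigcap_{n\in\mathbb N}\psi^{-n}(I_1\cup\dots\cup I_r)$. "Regular" means $C^k$-regular for some $k\ge 1$. Box dimension and box fuzzy measure: for compact $K$ and $\epsilon>0$ let $N_\epsilon(K)$ be the minimal number of open intervals of diameter $\epsilon$ needed to cover $K$. The box dimension of $K$ is $\inf\{s\ge0:\ \limsup_{\epsilon\to0}N_\epsilon(K)\epsilon^s=0\}$. With $d$ the box dimension of $K$, the box fuzzy measure is $C_K:=\sup_{0<\epsilon\le\operatorname{diam}K}N_\epsilon(K)\,\epsilon^{d}$. The dimension $d$ of $K$ is its box dimension (for regular Cantor sets of class $C^{1+\alpha}$ it is a known theorem that it coincides with the Hausdorff dimension and that $C_K<\infty$). *)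

theory Defs
  imports "HOL-Analysis.Analysis"
begin

definition cantor_set :: "real set \<Rightarrow> bool" where
  "cantor_set K \<longleftrightarrow> K \<noteq> {} \<and> compact K \<and> (\<forall>x\<in>K. x islimpt K) \<and>
     (\<forall>C. C \<subseteq> K \<and> connected C \<longrightarrow> (\<exists>x. C \<subseteq> {x}))"

definition gaps :: "real set \<Rightarrow> real set set" where
  "gaps K = components (convex hull K - K)"

(* The gaps of a compact K are bounded open intervals, so their diameters are their lengths. *)
definition condition_C :: "real \<Rightarrow> real set \<Rightarrow> bool" where
  "condition_C p K \<longleftrightarrow> compact K \<and> (\<lambda>G. diameter G powr p) summable_on gaps K"

(* Intended for open U: there the iterated derivatives depend only on the values of f on U. *)
definition C_k_on :: "nat \<Rightarrow> (real \<Rightarrow> real) \<Rightarrow> real set \<Rightarrow> bool" where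
  "C_k_on k f U \<longleftrightarrow> (\<forall>i<k. (deriv ^^ i) f differentiable_on U) \<and> continuous_on U ((deriv ^^ k) f)"

(* The map psi lives on the open neighbourhood U; its values outside U are irrelevant, since
   the sets below only involve iterates of points whose orbits stay in the intervals I j.
   The intersection over n starts at n = 0. *)
definition C_k_regular_cantor_set :: "nat \<Rightarrow> real set \<Rightarrow> bool" where
  "C_k_regular_cantor_set k K \<longleftrightarrow> cantor_set K \<and>
     (\<exists>(r::nat) (I :: nat \<Rightarrow> real set) U \<psi>.
        (\<forall>j\<in>{1..r}. \<exists>a b. a < b \<and> I j = {a..b}) \<and>
        disjoint_family_on I {1..r} \<and>
        K \<subseteq> (\<Union>j\<in>{1..r}. I j) \<and>
        (\<forall>j\<in>{1..r}. frontier (I j) \<subseteq> K) \<and>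
        open U \<and> (\<Union>j\<in>{1..r}. I j) \<subseteq> U \<and>
        C_k_on k \<psi> U \<and> (\<forall>x\<in>U. \<bar>deriv \<psi> x\<bar> > 1) \<and>
        (\<forall>j\<in>{1..r}. \<exists>S\<subseteq>{1..r}. \<psi> ` I j = convex hull (\<Union>s\<in>S. I s)) \<and>
        (\<forall>j\<in>{1..r}. \<forall>\<^sub>F n in sequentially. (\<psi> ^^ n) ` (K \<inter> I j) = K) \<and>
        K = (\<Inter>n. (\<psi> ^^ n) -` (\<Union>j\<in>{1..r}. I j)))"

definition regular_cantor_set :: "real set \<Rightarrow> bool" where
  "regular_cantor_set K \<longleftrightarrow> (\<exists>k\<ge>1. C_k_regular_cantor_set k K)"

definition covering_number :: "real \<Rightarrow> real set \<Rightarrow> nat" where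
  "covering_number \<epsilon> K =
     (LEAST n. \<exists>\<U>. finite \<U> \<and> card \<U> = n \<and> (\<forall>U\<in>\<U>. \<exists>x. U = {x<..<x + \<epsilon>}) \<and> K \<subseteq> \<Union>\<U>)"

definition box_dimension :: "real set \<Rightarrow> real" where
  "box_dimension K =
     Inf {s. 0 \<le> s \<and> Limsup (at_right 0) (\<lambda>\<epsilon>. ereal (real (covering_number \<epsilon> K) * \<epsilon> powr s)) = 0}"

(* Extended-valued: the supremum may be infinite. *)
definition box_fuzzy_measure :: "real set \<Rightarrow> ennreal" where
  "box_fuzzy_measure K =
     (SUP \<epsilon>\<in>{0<..diameter K}. ennreal (real (covering_number \<epsilon> K) * \<epsilon> powr box_dimension K))"

end

theory Submission
  imports Defs
begin

text \<open>
  Apart from the translates leaving the hull of \<open>Kt\<close>, a parameter \<open>t\<close> is bad only if some \<open>t + K\<close>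
  meets a gap \<open>{a n<..<b n}\<close>.  For a long gap, the bad parameters lie in an interval of length
  \<open>diameter K + l n\<close>.  For a short gap, cover \<open>K\<close> by \<open>N\<close> open intervals of length \<open>l n\<close>, with \<open>N\<close>
  minimal; each contributes an interval of length \<open>2 * l n\<close> of bad parameters, and
  \<open>N \<le> C\<^sub>K * l n powr (- d)\<close>.
\<close>

text \<open>On the real line this is the Minkowski difference of \<open>G\<close> and
  \<open>K\<close>. It is monotone in \<open>K\<close> and turns unions in \<open>K\<close> into
  unions, so it passes from \<open>K\<close> to any cover of \<open>K\<close>.\<close>

definition hitting_set :: "'a::plus set \<Rightarrow> 'a set \<Rightarrow> 'a set" where
  "hitting_set G K = {t. \<exists>x\<in>K. t + x \<in> G}"

lemma hitting_set_mono: "K \<subseteq> L \<Longrightarrow> hitting_set G K \<subseteq> hitting_set G L"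
  by (auto simp: hitting_set_def)

lemma hitting_set_Union: "hitting_set G (\<Union>\<U>) = (\<Union>U\<in>\<U>. hitting_set G U)"
  by (auto simp: hitting_set_def)

text \<open>The set is a union of translates of \<open>G\<close>, one for each point of
  \<open>K\<close>. This makes the sets of bad parameters Borel.\<close>

lemma open_hitting_set:
  fixes G :: "'a::real_normed_vector set"
  assumes "open G"
  shows "open (hitting_set G K)"
proof -
  have "hitting_set G K = (\<Union>x\<in>K. (\<lambda>y. y - x) ` G)"
    by (force simp: hitting_set_def)
  then show ?thesis
    using open_translation_subtract[OF assms] by (auto intro: open_UN)
qed

lemma closed_translates_subset:
  fixes F K :: "'a::real_normed_vector set"
  assumes "closed F"
  shows "closed {t. (\<lambda>x. t + x) ` K \<subseteq> F}"
proof -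
  have "{t. (\<lambda>x. t + x) ` K \<subseteq> F} = - hitting_set (- F) K"
    by (auto simp: hitting_set_def)
  then show ?thesis
    using assms open_hitting_set[of "- F" K] by (simp add: closed_def)
qed

lemma hitting_set_interval_subset:
  fixes a b u v :: real
  shows "hitting_set {a<..<b} {u..v} \<subseteq> {a - v<..<b - u}"
  by (auto simp: hitting_set_def)

lemma compact_subset_interval_diameter:
  fixes K :: "real set"
  assumes "compact K" "K \<noteq> {}"
  obtains m where "K \<subseteq> {m..m + diameter K}"
proof -
  obtain m where m: "m \<in> K" "\<And>x. x \<in> K \<Longrightarrow> m \<le> x"
    using compact_attains_inf[OF assms] by blast
  have "x \<le> m + diameter K" if "x \<in> K" for x
    using diameter_bounded_bound[OF compact_imp_bounded[OF assms(1)] that m(1)]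
    by (auto simp: dist_real_def)
  then show thesis
    using m(2) by (intro that[of m]) auto
qed

text \<open>A value given by \<open>LEAST\<close> is attained only once some finite cover is known
  to exist; compactness provides one.\<close>

lemma covering_number_attained:
  assumes "compact K" "\<epsilon> > 0"
  obtains \<U> where "finite \<U>" "card \<U> = covering_number \<epsilon> K"
    "\<And>U. U \<in> \<U> \<Longrightarrow> \<exists>x. U = {x<..<x + \<epsilon>}" "K \<subseteq> \<Union>\<U>"
proof -
  let ?P = "\<lambda>n. \<exists>\<U>. finite \<U> \<and> card \<U> = n \<and> (\<forall>U\<in>\<U>. \<exists>x. U = {x<..<x + \<epsilon>}) \<and> K \<subseteq> \<Union>\<U>"
  have "K \<subseteq> (\<Union>x\<in>UNIV. {x<..<x + \<epsilon>})"
  proof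
    fix y
    have "y \<in> {y - \<epsilon> / 2<..<y - \<epsilon> / 2 + \<epsilon>}"
      using assms(2) by auto
    then show "y \<in> (\<Union>x\<in>UNIV. {x<..<x + \<epsilon>})"
      by blast
  qed
  then obtain C where C: "finite C" "K \<subseteq> (\<Union>x\<in>C. {x<..<x + \<epsilon>})"
    using compactE_image[OF assms(1), of UNIV "\<lambda>x. {x<..<x + \<epsilon>}"] by (metis open_greaterThanLessThan)
  have "?P (card ((\<lambda>x. {x<..<x + \<epsilon>}) ` C))"
    using C by (intro exI[of _ "(\<lambda>x. {x<..<x + \<epsilon>}) ` C"]) auto
  then have "?P (covering_number \<epsilon> K)"
    unfolding covering_number_def by (rule LeastI)
  then show thesis
    using that by blast
qed

text \<open>Enclose \<open>K\<close> in an interval of length \<open>diameter K\<close>: the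
  difference of two intervals is an interval whose length is the sum of theirs.\<close>

lemma emeasure_hitting_set_le_hull:
  fixes a b :: real
  assumes "compact K" "K \<noteq> {}" "a < b"
  shows "emeasure lborel (hitting_set {a<..<b} K) \<le> ennreal (diameter K + (b - a))"
proof -
  obtain m where m: "K \<subseteq> {m..m + diameter K}"
    using compact_subset_interval_diameter assms by blast
  have "emeasure lborel (hitting_set {a<..<b} K)
      \<le> emeasure lborel {a - (m + diameter K)<..<b - m}"
    using order_trans[OF hitting_set_mono[OF m] hitting_set_interval_subset]
    by (intro emeasure_mono) auto
  also have "\<dots> = ennreal (diameter K + (b - a))"
    using assms diameter_ge_0[OF compact_imp_bounded[OF assms(1)]]
    by (simp add: algebra_simps)
  finally show ?thesis .
qed

text \<open>The covering scale is the gap length itself, so each piece and the gap have equal length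
  and their difference has length \<open>2 * (b - a)\<close>. This is the source of the factor 2;
  subadditivity over a minimal cover does the rest.\<close>

lemma emeasure_hitting_set_le_covering_number:
  fixes a b :: real
  assumes "compact K" "a < b"
  shows "emeasure lborel (hitting_set {a<..<b} K) \<le> ennreal (2 * (b - a) * covering_number (b - a) K)"
proof -
  obtain \<U> where \<U>: "finite \<U>" "card \<U> = covering_number (b - a) K"
    "\<And>U. U \<in> \<U> \<Longrightarrow> \<exists>x. U = {x<..<x + (b - a)}" "K \<subseteq> \<Union>\<U>"
    using covering_number_attained[OF assms(1), of "b - a"] assms(2) by auto
  have one: "emeasure lborel (hitting_set {a<..<b} U) \<le> ennreal (2 * (b - a))" if U: "U \<in> \<U>" for U
  proof -
    obtain x where x: "U = {x<..<x + (b - a)}"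
      using \<U>(3)[OF U] by blast
    have "hitting_set {a<..<b} U \<subseteq> {a - (x + (b - a))<..<b - x}"
      by (auto simp: x hitting_set_def)
    then have "emeasure lborel (hitting_set {a<..<b} U) \<le> emeasure lborel {a - (x + (b - a))<..<b - x}"
      by (intro emeasure_mono) auto
    also have "\<dots> = ennreal (2 * (b - a))"
      using assms by simp
    finally show ?thesis .
  qed
  have "emeasure lborel (hitting_set {a<..<b} K) \<le> emeasure lborel (\<Union>U\<in>\<U>. hitting_set {a<..<b} U)"
    using hitting_set_mono[OF \<U>(4)] \<U>(1)
    by (intro emeasure_mono) (auto simp: hitting_set_Union intro!: borel_open open_hitting_set)
  also have "\<dots> \<le> (\<Sum>U\<in>\<U>. emeasure lborel (hitting_set {a<..<b} U))"
    using \<U>(1) by (intro emeasure_subadditive_finite) (auto intro!: borel_open open_hitting_set)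
  also have "\<dots> \<le> (\<Sum>U\<in>\<U>. ennreal (2 * (b - a)))"
    by (intro sum_mono one)
  also have "\<dots> = ennreal (2 * (b - a) * covering_number (b - a) K)"
    using assms(2) by (simp add: \<U>(2) ennreal_mult ennreal_of_nat_eq_real_of_nat mult.commute)
  finally show ?thesis .
qed

lemma covering_number_le_box_fuzzy_measure:
  assumes "0 < \<epsilon>" "\<epsilon> \<le> diameter K"
  shows "ennreal (covering_number \<epsilon> K * \<epsilon> powr box_dimension K) \<le> box_fuzzy_measure K"
  unfolding box_fuzzy_measure_def using assms by (intro SUP_upper) auto

lemma emeasure_hitting_set_le_box_fuzzy_measure:
  fixes a b :: real
  assumes "compact K" "a < b" "b - a \<le> diameter K"
  shows "emeasure lborel (hitting_set {a<..<b} K)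
    \<le> 2 * box_fuzzy_measure K * ennreal ((b - a) powr (1 - box_dimension K))"
proof -
  let ?N = "real (covering_number (b - a) K)" and ?d = "box_dimension K"
  \<comment> \<open>One factor \<open>b - a\<close> is split so that
    \<open>?N * (b - a) powr ?d\<close> appears, a term of the supremum defining
    \<open>box_fuzzy_measure K\<close> because \<open>b - a\<close> is at most
    \<open>diameter K\<close>.\<close>
  have "(b - a) powr ?d * (b - a) powr (1 - ?d) = b - a"
    using assms(2) by (simp flip: powr_add)
  then have eq: "2 * (b - a) * ?N = 2 * (?N * (b - a) powr ?d) * (b - a) powr (1 - ?d)"
    by (simp add: mult.assoc)
  have "emeasure lborel (hitting_set {a<..<b} K) \<le> ennreal (2 * (b - a) * ?N)"
    by (rule emeasure_hitting_set_le_covering_number[OF assms(1,2)])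
  also have "\<dots> = 2 * ennreal (?N * (b - a) powr ?d) * ennreal ((b - a) powr (1 - ?d))"
    unfolding eq by (simp add: ennreal_mult)
  also have "\<dots> \<le> 2 * box_fuzzy_measure K * ennreal ((b - a) powr (1 - ?d))"
    using covering_number_le_box_fuzzy_measure[of "b - a" K] assms
    by (intro mult_right_mono mult_left_mono) auto
  finally show ?thesis .
qed

text \<open>Nonnegative families are always summable in \<open>ennreal\<close>, so the order of
  summation is irrelevant. This links the unordered sums in \<open>S\<close> with the series from
  countable subadditivity.\<close>

lemma infsum_ennreal_eq_suminf:
  fixes f :: "nat \<Rightarrow> ennreal"
  shows "infsum f A = (\<Sum>n. if n \<in> A then f n else 0)"
proof -
  have "infsum f A = (\<Sum>\<^sub>\<infinity>n. if n \<in> A then f n else 0)"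
    by (rule infsum_cong_neutral) auto
  also have "((\<lambda>n. if n \<in> A then f n else 0) has_sum \<dots>) UNIV"
    by (intro has_sum_infsum nonneg_summable_on_complete) auto
  from has_sum_imp_sums[OF this] have "(\<Sum>\<^sub>\<infinity>n. if n \<in> A then f n else 0) = (\<Sum>n. if n \<in> A then f n else 0)"
    by (rule sums_unique)
  finally show ?thesis .
qed

text \<open>The translations that keep an enclosing interval of \<open>K\<close> inside
  \<open>{0..D}\<close> fill an interval of length \<open>D - diameter K\<close>. Each of them is
  good or makes \<open>K\<close> hit some gap.\<close>

lemma emeasure_translates_into_interval_minus_gaps:
  fixes K :: "real set" and a b :: "nat \<Rightarrow> real"
  assumes "compact K" "K \<noteq> {}"
    and closed: "closed ({0..D} - (\<Union>n. {a n<..<b n}))"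
  shows "ennreal (D - diameter K) \<le>
    emeasure lebesgue {t. (\<lambda>x. t + x) ` K \<subseteq> {0..D} - (\<Union>n. {a n<..<b n})}
    + (\<Sum>n. emeasure lborel (hitting_set {a n<..<b n} K))"
proof (cases "diameter K \<le> D")
  case True
  define T where "T = {t. (\<lambda>x. t + x) ` K \<subseteq> {0..D} - (\<Union>n. {a n<..<b n})}"
  define B where "B = (\<lambda>n. hitting_set {a n<..<b n} K)"
  have T: "T \<in> sets borel"
    unfolding T_def by (intro borel_closed closed_translates_subset closed)
  have B: "B n \<in> sets borel" for n
    unfolding B_def by (intro borel_open open_hitting_set) auto
  obtain m where m: "K \<subseteq> {m..m + diameter K}"
    using compact_subset_interval_diameter assms(1,2) by blast
  have "{- m..D - diameter K - m} \<subseteq> T \<union> (\<Union>n. B n)"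
    using m by (fastforce simp: T_def B_def hitting_set_def)
  then have "emeasure lborel {- m..D - diameter K - m} \<le> emeasure lborel (T \<union> (\<Union>n. B n))"
    using T B by (intro emeasure_mono) auto
  also have "\<dots> \<le> emeasure lborel T + emeasure lborel (\<Union>n. B n)"
    using T B by (intro emeasure_subadditive) auto
  also have "\<dots> \<le> emeasure lborel T + (\<Sum>n. emeasure lborel (B n))"
    using B by (intro add_left_mono emeasure_subadditive_countably) auto
  \<comment> \<open>Since \<open>T\<close> is Borel, its \<open>lebesgue\<close> and
    \<open>lborel\<close> measures agree.\<close>
  finally show ?thesis
    using True T by (simp add: T_def[symmetric] B_def)
\<comment> \<open>If \<open>D < diameter K\<close>, the left-hand side is \<open>ennreal\<close> of
  a negative number, hence 0.\<close>
qed (simp add: ennreal_neg)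

theorem theorem2p1:
  fixes p d :: real and Kt K :: "real set" and a b l :: "nat \<Rightarrow> real" and S :: ennreal
  assumes "0 < p" and "p < 1"
    and "cantor_set Kt" and "condition_C p Kt"
    and "Kt = {0..diameter Kt} - (\<Union>n. {a n<..<b n})"
    and "bij_betw (\<lambda>n. {a n<..<b n}) UNIV (components ({0..diameter Kt} - Kt))"
    and "\<And>n. l n = b n - a n"
    and "regular_cantor_set K" and "d = box_dimension K" and "d < 1 - p"
    and "S = (\<Sum>\<^sub>\<infinity>n\<in>{n. l n > diameter K}. ennreal (diameter K + l n))
           + 2 * box_fuzzy_measure K * (\<Sum>\<^sub>\<infinity>n\<in>{n. l n \<le> diameter K}. ennreal (l n powr (1 - d)))"
    and "S < ennreal (diameter Kt - diameter K)"
  shows "emeasure lebesgue {t. (\<lambda>x. t + x) ` K \<subseteq> Kt} > 0 \<and>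
         emeasure lebesgue {t. (\<lambda>x. t + x) ` K \<subseteq> Kt} \<ge> ennreal (diameter Kt - diameter K) - S"
proof -
  let ?T = "{t. (\<lambda>x. t + x) ` K \<subseteq> Kt}"
  let ?C = "2 * box_fuzzy_measure K"
  let ?f = "\<lambda>n. emeasure lborel (hitting_set {a n<..<b n} K)"
  \<comment> \<open>Both families are extended by 0 in the form used by
    \<open>infsum_ennreal_eq_suminf\<close>, so that the total later matches \<open>S\<close>
    syntactically.\<close>
  let ?long = "\<lambda>n. if n \<in> {n. l n > diameter K} then ennreal (diameter K + l n) else 0"
  let ?short = "\<lambda>n. if n \<in> {n. l n \<le> diameter K} then ennreal (l n powr (1 - d)) else 0"
  have K: "compact K" "K \<noteq> {}"
    using \<open>regular_cantor_set K\<close>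
    by (auto simp: regular_cantor_set_def C_k_regular_cantor_set_def cantor_set_def)
  have gap: "a n < b n" for n
  \<comment> \<open>Components are nonempty, which forces the endpoints into the right
    order.\<close>
  proof -
    have "{a n<..<b n} \<in> components ({0..diameter Kt} - Kt)"
      using assms(6) by (auto simp: bij_betw_def)
    then show ?thesis
      using in_components_nonempty by fastforce
  qed
  \<comment> \<open>For each \<open>n\<close> one of the two summands vanishes, and the estimate for
    long or short gaps bounds \<open>?f n\<close> by the other.\<close>
  have bound: "?f n \<le> ?long n + ?C * ?short n" for n
    using emeasure_hitting_set_le_hull[OF K gap[of n]]
      emeasure_hitting_set_le_box_fuzzy_measure[OF K(1) gap[of n]]
    by (cases "l n \<le> diameter K") (auto simp: assms(7,9))
  have "(\<Sum>n. ?f n) \<le> (\<Sum>n. ?long n + ?C * ?short n)"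
    by (intro suminf_le bound) auto
  also have "\<dots> = (\<Sum>n. ?long n) + ?C * (\<Sum>n. ?short n)"
    by (subst suminf_add[symmetric]) (auto simp only: ennreal_suminf_cmult intro: summableI)
  also have "\<dots> = S"
    unfolding assms(11) infsum_ennreal_eq_suminf ..
  finally have sum: "(\<Sum>n. ?f n) \<le> S" .
  have closed: "closed ({0..diameter Kt} - (\<Union>n. {a n<..<b n}))"
    by (intro closed_Diff open_UN) auto
  have "ennreal (diameter Kt - diameter K) \<le> emeasure lebesgue ?T + (\<Sum>n. ?f n)"
    using emeasure_translates_into_interval_minus_gaps[OF K closed] assms(5) by simp
  also have "\<dots> \<le> emeasure lebesgue ?T + S"
    using sum by (rule add_left_mono)
  \<comment> \<open>Moving \<open>S\<close> across is safe in \<open>ennreal\<close>: the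
    exceptional case of an infinite minuend is excluded, as the minuend is \<open>ennreal\<close> of
    a real number.\<close>
  finally have "ennreal (diameter Kt - diameter K) - S \<le> emeasure lebesgue ?T"
    by (auto simp: ennreal_minus_le_iff add.commute)
  moreover have "0 < ennreal (diameter Kt - diameter K) - S"
    using assms(12) by (rule diff_gr0_ennreal)
  ultimately show ?thesis
    by (auto intro: less_le_trans)
qed

end
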